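(* Let $R$ be an associative ring with identity and let $I$ be an ideal of $R$ such that $R/I$ is strongly nil-IFP. If $I$ is a semicommutative ideal of $R$, then $R$ is strongly nil-IFP.
   Context: Rings are not necessarily commutative. For a ring $A$, $N(A)$ denotes the set of nilpotent elements of $A$, and for $f\in A[x]$, $C_{f(x)}$ denotes the set of all coefficients of $f$. A ring $A$ is strongly nil-IFP if whenever $f(x),g(x)\in A[x]$ satisfy $f(x)g(x)=0$, then $arb\in N(A)$ for all $a\in C_{f(x)}$, $b\in C_{g(x)}$ and all $r\in A$. A ring $A$ (possibly without identity) is semicommutative if for $a,b\in A$, $ab=0$ implies $aAb=0$. An ideal $I$ is called semicommutative if it is semicommutative as a ring (possibly without identity), i.e. $a,b\in I$ and $ab=0$ imply $arb=0$ for all $r\in I$. *)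

theory Defs
  imports "HOL-Algebra.QuotRing" "HOL-Algebra.UnivPoly"
begin

definition nilpotents :: "('a, 'm) ring_scheme \<Rightarrow> 'a set"
  where "nilpotents A = {a \<in> carrier A. \<exists>n::nat. n > 0 \<and> a [^]\<^bsub>A\<^esub> n = \<zero>\<^bsub>A\<^esub>}"

(* C_f: the full coefficient sequence of f is used, so 0 always belongs to it. *)
definition coeffs_of :: "('a, 'm) ring_scheme \<Rightarrow> (nat \<Rightarrow> 'a) \<Rightarrow> 'a set"
  where "coeffs_of A f = range (coeff (UP A) f)"

(* UP A is A[x] with a central indeterminate; its product is the convolution
   in the order of the factors, so A need not be commutative. *)
definition strongly_nil_IFP :: "('a, 'm) ring_scheme \<Rightarrow> bool"
  where "strongly_nil_IFP A \<longleftrightarrow>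
    (\<forall>f \<in> carrier (UP A). \<forall>g \<in> carrier (UP A).
      f \<otimes>\<^bsub>UP A\<^esub> g = \<zero>\<^bsub>UP A\<^esub> \<longrightarrow>
      (\<forall>a \<in> coeffs_of A f. \<forall>b \<in> coeffs_of A g. \<forall>r \<in> carrier A.
        a \<otimes>\<^bsub>A\<^esub> r \<otimes>\<^bsub>A\<^esub> b \<in> nilpotents A))"

(* The identity of the record A plays no role, so this also applies to rings without identity. *)
definition semicommutative :: "('a, 'm) ring_scheme \<Rightarrow> bool"
  where "semicommutative A \<longleftrightarrow>
    (\<forall>a \<in> carrier A. \<forall>b \<in> carrier A.
      a \<otimes>\<^bsub>A\<^esub> b = \<zero>\<^bsub>A\<^esub> \<longrightarrow>
      (\<forall>r \<in> carrier A. a \<otimes>\<^bsub>A\<^esub> r \<otimes>\<^bsub>A\<^esub> b = \<zero>\<^bsub>A\<^esub>))"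

(* I as a ring in its own right: the multiplying element r also ranges over I only. *)
definition semicommutative_ideal :: "'a set \<Rightarrow> ('a, 'm) ring_scheme \<Rightarrow> bool"
  where "semicommutative_ideal I R \<longleftrightarrow> ideal I R \<and> semicommutative (R\<lparr>carrier := I\<rparr>)"

end

theory Submission
  imports Defs
begin

text \<open>
  The nilpotent elements of a semicommutative ideal \<open>I\<close> form an ideal \<open>N\<close> of \<open>R\<close>, and \<open>I\<close> is
  reduced modulo \<open>N\<close>. If \<open>f g = 0\<close> in \<open>R[x]\<close> then, multiplying \<open>g\<close> on the right by \<open>u \<in> I\<close>, the
  Armendariz argument for reduced rings yields \<open>a\<^sub>i b\<^sub>j u \<in> N\<close> for all \<open>i, j\<close>, and hence even
  \<open>a\<^sub>i r b\<^sub>j u \<in> N\<close> for all \<open>r\<close>. The hypothesis on \<open>R/I\<close> provides a power of \<open>c = a\<^sub>i r b\<^sub>j\<close> in \<open>I\<close>;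
  taking it as \<open>u\<close> makes the next power of \<open>c\<close> lie in \<open>N\<close>.
\<close>

section \<open>Nilpotent elements of a semicommutative ideal\<close>

lemma semicommutative_idealD:
  assumes "semicommutative_ideal I R"
    and "a \<in> I" "b \<in> I" "r \<in> I" "a \<otimes>\<^bsub>R\<^esub> b = \<zero>\<^bsub>R\<^esub>"
  shows "a \<otimes>\<^bsub>R\<^esub> r \<otimes>\<^bsub>R\<^esub> b = \<zero>\<^bsub>R\<^esub>"
  using assms by (simp add: semicommutative_ideal_def semicommutative_def)

lemma nilpotentsI:
  "a \<in> carrier A \<Longrightarrow> a [^]\<^bsub>A\<^esub> Suc n = \<zero>\<^bsub>A\<^esub> \<Longrightarrow> a \<in> nilpotents A"
  unfolding nilpotents_def by blast

lemma (in ideal) nat_pow_mem: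
  assumes "a \<in> I" "n > 0"
  shows "a [^] (n::nat) \<in> I"
proof -
  obtain m where "n = Suc m" using assms(2) gr0_conv_Suc by blast
  then show ?thesis using assms(1) Icarr I_l_closed by simp
qed

lemma (in ring) nilpotents_pow:
  assumes "a \<in> carrier R" "a [^] (k::nat) \<in> nilpotents R" "k > 0"
  shows "a \<in> nilpotents R"
proof -
  obtain n :: nat where "n > 0" "(a [^] k) [^] n = \<zero>"
    using assms(2) unfolding nilpotents_def by blast
  then have "a [^] (k * n) = \<zero>" "k * n > 0" using assms by (auto simp: nat_pow_pow)
  then show ?thesis using assms(1) unfolding nilpotents_def by blast
qed

text \<open>A power of \<open>b a\<close> is the next lower power of \<open>a b\<close> enclosed
  between \<open>b\<close> and \<open>a\<close>.\<close>

lemma (in ring) nilpotents_mult_commute: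
  assumes "a \<in> carrier R" "b \<in> carrier R" "a \<otimes> b \<in> nilpotents R"
  shows "b \<otimes> a \<in> nilpotents R"
proof -
  obtain n :: nat where n: "(a \<otimes> b) [^] n = \<zero>"
    using assms(3) unfolding nilpotents_def by blast
  have "(b \<otimes> a) [^] Suc k = b \<otimes> ((a \<otimes> b) [^] k) \<otimes> a" for k :: nat
  proof (induction k)
    case 0
    show ?case using assms by simp
  next
    case (Suc k)
    have "(b \<otimes> a) [^] Suc (Suc k) = b \<otimes> ((a \<otimes> b) [^] k) \<otimes> a \<otimes> (b \<otimes> a)"
      using Suc by (metis nat_pow_Suc)
    then show ?case using assms by (simp add: m_assoc)
  qed
  from this[of n] n have "(b \<otimes> a) [^] Suc n = \<zero>" using assms by simp
  then show ?thesis using assms by (intro nilpotentsI) auto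
qed

text \<open>The factor \<open>x\<close> drives the induction: absorbing the last \<open>a\<close> or
  \<open>b\<close> of the power into \<open>x\<close> lowers \<open>p\<close> or \<open>q\<close> by
  one, and semicommutativity preserves the other annihilation condition.\<close>

lemma (in ring) semicommutative_ideal_pow_add:
  assumes I: "semicommutative_ideal I R" and "a \<in> I" "b \<in> I" "x \<in> I"
    and "a [^] (p::nat) \<otimes> x = \<zero>" "b [^] (q::nat) \<otimes> x = \<zero>"
  shows "(a \<oplus> b) [^] (p + q) \<otimes> x = \<zero>"
  using assms(4-)
proof (induction "p + q" arbitrary: p q x)
  case 0
  interpret I: ideal I R using I by (simp add: semicommutative_ideal_def)
  show ?case using 0 I.Icarr by simp
next
  case (Suc k)
  interpret I: ideal I R using I by (simp add: semicommutative_ideal_def)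
  have carr: "a \<in> carrier R" "b \<in> carrier R" "x \<in> carrier R"
    using I.Icarr assms Suc.prems by auto
  show ?case
  proof (cases "p = 0 \<or> q = 0")
    case True
    then have "x = \<zero>" using Suc.prems carr by auto
    then show ?thesis using carr by simp
  next
    case False
    then obtain p' q' where pq: "p = Suc p'" "q = Suc q'" by (meson not0_implies_Suc)
    have mem: "a \<otimes> x \<in> I" "b \<otimes> x \<in> I" using carr Suc.prems(1) I.I_l_closed by auto
    \<comment> \<open>Positive exponents matter: the zeroth power is the identity, which need not
      lie in \<open>I\<close>.\<close>
    have powI: "a [^] p \<in> I" "b [^] q \<in> I"
      using pq assms(2,3) I.nat_pow_mem[OF _ zero_less_Suc] by blast+
    have ax: "(a \<oplus> b) [^] (p' + q) \<otimes> (a \<otimes> x) = \<zero>"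
    proof (rule Suc.hyps(1))
      show "k = p' + q" using Suc.hyps(2) pq by simp
      show "a [^] p' \<otimes> (a \<otimes> x) = \<zero>" using Suc.prems pq carr by (simp add: m_assoc)
      show "b [^] q \<otimes> (a \<otimes> x) = \<zero>"
        using semicommutative_idealD[OF I powI(2) Suc.prems(1) assms(2) Suc.prems(3)] carr
        by (simp add: m_assoc)
    qed (fact mem)
    have bx: "(a \<oplus> b) [^] (p + q') \<otimes> (b \<otimes> x) = \<zero>"
    proof (rule Suc.hyps(1))
      show "k = p + q'" using Suc.hyps(2) pq by simp
      show "b [^] q' \<otimes> (b \<otimes> x) = \<zero>" using Suc.prems pq carr by (simp add: m_assoc)
      show "a [^] p \<otimes> (b \<otimes> x) = \<zero>"
        using semicommutative_idealD[OF I powI(1) Suc.prems(1) assms(3) Suc.prems(2)] carr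
        by (simp add: m_assoc)
    qed (fact mem)
    have k: "p + q = Suc k" "p' + q = k" "p + q' = k" using pq Suc.hyps(2) by auto
    have "(a \<oplus> b) [^] (p + q) \<otimes> x
        = (a \<oplus> b) [^] k \<otimes> (a \<otimes> x) \<oplus> (a \<oplus> b) [^] k \<otimes> (b \<otimes> x)"
      using carr unfolding k by (simp add: m_assoc l_distr r_distr)
    then show ?thesis using ax bx k by simp
  qed
qed

text \<open>Semicommutativity of \<open>I\<close> does not allow inserting an arbitrary
  \<open>r\<close>, but \<open>r a r\<close> lies in \<open>I\<close>. So two factors
  \<open>a r\<close> are absorbed into \<open>x\<close> for each unit of \<open>p\<close>, whence
  the exponent \<open>2 * p\<close>.\<close>

lemma (in ring) semicommutative_ideal_pow_mult:
  assumes I: "semicommutative_ideal I R" and "a \<in> I" "r \<in> carrier R" "x \<in> I"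
    and "a [^] (p::nat) \<otimes> x = \<zero>"
  shows "(a \<otimes> r) [^] (2 * p) \<otimes> x = \<zero>"
  using assms(4-)
proof (induction p arbitrary: x)
  case 0
  interpret I: ideal I R using I by (simp add: semicommutative_ideal_def)
  show ?case using 0 I.Icarr by simp
next
  case (Suc p)
  interpret I: ideal I R using I by (simp add: semicommutative_ideal_def)
  have carr: "a \<in> carrier R" "r \<in> carrier R" "x \<in> carrier R"
    using I.Icarr assms Suc.prems by auto
  have mem: "r \<otimes> a \<otimes> r \<in> I" "a [^] Suc p \<in> I" "a \<otimes> r \<otimes> (a \<otimes> r) \<otimes> x \<in> I"
    using carr assms(2) Suc.prems(1) I.I_l_closed I.I_r_closed I.nat_pow_mem by auto
  have "a [^] p \<otimes> (a \<otimes> r \<otimes> (a \<otimes> r) \<otimes> x) = a [^] Suc p \<otimes> (r \<otimes> a \<otimes> r) \<otimes> x"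
    using carr by (simp add: m_assoc)
  also have "\<dots> = \<zero>"
    using semicommutative_idealD[OF I mem(2) Suc.prems(1) mem(1) Suc.prems(2)] .
  finally have "(a \<otimes> r) [^] (2 * p) \<otimes> (a \<otimes> r \<otimes> (a \<otimes> r) \<otimes> x) = \<zero>"
    using Suc.IH mem(3) by blast
  then show ?case using carr by (simp add: m_assoc)
qed

lemma (in ring) ideal_nilpotents_semicommutative_ideal:
  assumes I: "semicommutative_ideal I R"
  shows "ideal (nilpotents R \<inter> I) R"
proof -
  interpret I: ideal I R using I by (simp add: semicommutative_ideal_def)
  have add: "a \<oplus> b \<in> nilpotents R \<inter> I"
    if ab: "a \<in> nilpotents R \<inter> I" "b \<in> nilpotents R \<inter> I" for a b
  proof -
    obtain p q :: nat where pq: "a [^] p = \<zero>" "b [^] q = \<zero>"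
      using ab unfolding nilpotents_def by blast
    have carr: "a \<in> carrier R" "b \<in> carrier R" using ab I.Icarr by auto
    have s: "a \<oplus> b \<in> I" using ab I.a_closed by blast
    \<comment> \<open>The auxiliary factor \<open>x\<close> is chosen as the sum itself, which costs
      one more power.\<close>
    have "(a \<oplus> b) [^] (p + q) \<otimes> (a \<oplus> b) = \<zero>"
      by (rule semicommutative_ideal_pow_add[OF I]) (use ab pq carr s in auto)
    then show ?thesis using carr s by (auto intro: nilpotentsI[where n="p+q"])
  qed
  have right: "a \<otimes> r \<in> nilpotents R \<inter> I"
    if a: "a \<in> nilpotents R \<inter> I" and r: "r \<in> carrier R" for a r
  proof -
    obtain p :: nat where p: "a [^] p = \<zero>" using a unfolding nilpotents_def by blast
    have ar: "a \<in> carrier R" "a \<otimes> r \<in> I" using a r I.Icarr I.I_r_closed by auto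
    have "(a \<otimes> r) [^] (2 * p) \<otimes> (a \<otimes> r) = \<zero>"
      by (rule semicommutative_ideal_pow_mult[OF I]) (use a p r ar in auto)
    then show ?thesis using ar r by (auto intro: nilpotentsI[where n="2*p"])
  qed
  have left: "r \<otimes> a \<in> nilpotents R \<inter> I"
    if a: "a \<in> nilpotents R \<inter> I" and r: "r \<in> carrier R" for a r
    \<comment> \<open>Nilpotency passes from \<open>a r\<close> to \<open>r a\<close>, so no
      left-handed power lemma has to be proved.\<close>
    using right[OF that] nilpotents_mult_commute[of a r] a r I.Icarr I.I_l_closed by auto
  show ?thesis
  proof (rule idealI)
    show "subgroup (nilpotents R \<inter> I) (add_monoid R)"
    proof
      show "nilpotents R \<inter> I \<subseteq> carrier (add_monoid R)" using I.Icarr by auto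
      show "\<one>\<^bsub>add_monoid R\<^esub> \<in> nilpotents R \<inter> I"
        using I.zero_closed by (auto intro: nilpotentsI[where n=0])
      show "x \<otimes>\<^bsub>add_monoid R\<^esub> y \<in> nilpotents R \<inter> I"
        if "x \<in> nilpotents R \<inter> I" "y \<in> nilpotents R \<inter> I" for x y
        using add that by simp
      show "inv\<^bsub>add_monoid R\<^esub> x \<in> nilpotents R \<inter> I" if "x \<in> nilpotents R \<inter> I" for x
        using left[OF that, of "\<ominus> \<one>"] that I.Icarr by (simp add: l_minus flip: a_inv_def)
    qed
  qed (use left right ring_axioms in auto)
qed

section \<open>The Armendariz argument\<close>

lemma (in ideal) finsum_mem:
  assumes "finite A" "\<And>i. i \<in> A \<Longrightarrow> f i \<in> I"
  shows "finsum R f A \<in> I"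
  using assms
proof (induction A rule: finite_induct)
  case empty
  show ?case by simp
next
  case (insert x A)
  then have "f \<in> A \<rightarrow> carrier R" "f x \<in> carrier R" using Icarr by auto
  then show ?case using insert by (simp add: a_closed)
qed

lemma (in ideal) add_mem_cancel:
  assumes "x \<in> carrier R" "y \<in> I" "x \<oplus> y \<in> I"
  shows "x \<in> I"
proof -
  have "x = (x \<oplus> y) \<oplus> \<ominus> y" using assms Icarr by (simp add: a_assoc r_neg)
  moreover have "(x \<oplus> y) \<oplus> \<ominus> y \<in> I" using assms by simp
  ultimately show ?thesis by simp
qed

text \<open>The image of \<open>I\<close> in the quotient by \<open>N\<close> is a reduced ring; the
  condition is phrased by elements of \<open>R\<close>, so that this quotient need not be
  formed.\<close>

locale reduced_ideal_mod = I: ideal I R + N: ideal N R for I and N and R (structure) +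
  assumes square_mem: "x \<in> I \<Longrightarrow> x \<otimes> x \<in> N \<Longrightarrow> x \<in> N"
begin

text \<open>The square of \<open>t s\<close> contains \<open>s t\<close> in its middle, and
  \<open>t s\<close> lies in \<open>I\<close> because one factor does.\<close>

lemma mult_mem_commute:
  assumes "s \<in> carrier R" "t \<in> carrier R" "s \<in> I \<or> t \<in> I" "s \<otimes> t \<in> N"
  shows "t \<otimes> s \<in> N"
proof (rule square_mem)
  show "t \<otimes> s \<in> I" using assms I.I_l_closed I.I_r_closed by auto
  have "t \<otimes> (s \<otimes> t) \<otimes> s \<in> N" using assms N.I_l_closed N.I_r_closed by auto
  then show "t \<otimes> s \<otimes> (t \<otimes> s) \<in> N" using assms by (simp add: I.m_assoc)
qed

text \<open>The product is turned around to \<open>t s\<close>, absorbs \<open>r\<close> on the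
  right, and is turned back.\<close>

lemma mult_mem_insert:
  assumes "s \<in> carrier R" "t \<in> I" "r \<in> carrier R" "s \<otimes> t \<in> N"
  shows "s \<otimes> r \<otimes> t \<in> N"
proof -
  have t: "t \<in> carrier R" using assms I.Icarr by auto
  have "t \<otimes> s \<otimes> r \<in> N"
    using mult_mem_commute[of s t] assms t N.I_r_closed by auto
  then have "t \<otimes> (s \<otimes> r) \<in> N" using assms t by (simp add: I.m_assoc)
  then show ?thesis using mult_mem_commute[of t "s \<otimes> r"] assms t by auto
qed

text \<open>Only the \<open>t j\<close> need to lie in \<open>I\<close>: the products
  \<open>a i t j\<close> then do too, and reducedness is applied to these alone.\<close>

lemma armendariz:
  fixes a t :: "nat \<Rightarrow> 'a"
  assumes a: "\<And>i. a i \<in> carrier R" and t: "\<And>j. t j \<in> I"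
    and conv: "\<And>k. (\<Oplus>i\<in>{..k}. a i \<otimes> t (k - i)) \<in> N"
  shows "a i \<otimes> t j \<in> N"
proof (induction "i + j" arbitrary: i j rule: less_induct)
  case less
  then have lower: "a i' \<otimes> t j' \<in> N" if "i' + j' < i + j" for i' j' using that by blast
  \<comment> \<open>Within a fixed degree, a second induction runs over the index of
    \<open>t\<close>.\<close>
  have "a i' \<otimes> t j' \<in> N" if "i' + j' = i + j" for i' j'
    using that
  proof (induction j' arbitrary: i' rule: less_induct)
    case (less j')
    let ?k = "i' + j'" and ?s = "\<lambda>l. a l \<otimes> t (i' + j' - l)"
    have tc: "t l \<in> carrier R" for l using t I.Icarr by blast
    \<comment> \<open>Left multiplication by \<open>t j'\<close> isolates the term at
      \<open>i'\<close> modulo \<open>N\<close>: for \<open>l < i'\<close> the product of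
      \<open>a l\<close> and \<open>t j'\<close> has lower degree, and for \<open>l > i'\<close> the
      inner induction covers \<open>?s l\<close>.\<close>
    have "t j' \<otimes> ?s l \<in> N" if l: "l \<in> {..?k} - {i'}" for l
    proof (cases "l < i'")
      case True
      then have "t j' \<otimes> a l \<in> N"
        using mult_mem_commute[of "a l" "t j'"] lower[of l j'] a t tc less.prems by auto
      then have "t j' \<otimes> a l \<otimes> t (?k - l) \<in> N" using N.I_r_closed tc by blast
      then show ?thesis using a tc by (simp add: I.m_assoc)
    next
      case False
      then have "?k - l < j'" "l + (?k - l) = i + j" using l less.prems by auto
      then have "?s l \<in> N" using less.IH by blast
      then show ?thesis using N.I_l_closed tc by blast
    qed
    then have rest: "(\<Oplus>l\<in>{..?k} - {i'}. t j' \<otimes> ?s l) \<in> N"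
      by (intro N.finsum_mem) auto
    have ins: "insert i' ({..?k} - {i'}) = {..?k}" by auto
    have "t j' \<otimes> (\<Oplus>l\<in>{..?k}. ?s l) = (\<Oplus>l\<in>{..?k}. t j' \<otimes> ?s l)"
      using a tc by (intro I.finsum_rdistr) auto
    also have "\<dots> = t j' \<otimes> ?s i' \<oplus> (\<Oplus>l\<in>{..?k} - {i'}. t j' \<otimes> ?s l)"
      using I.finsum_insert[of "{..?k} - {i'}" i' "\<lambda>l. t j' \<otimes> ?s l"] a tc
      unfolding ins by auto
    finally have "t j' \<otimes> ?s i' \<oplus> (\<Oplus>l\<in>{..?k} - {i'}. t j' \<otimes> ?s l) \<in> N"
      using N.I_l_closed[OF conv[of ?k] tc[of j']] by simp
    then have "t j' \<otimes> ?s i' \<in> N" by (rule N.add_mem_cancel[OF _ rest, rotated]) (use a tc in auto)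
    then have "t j' \<otimes> (a i' \<otimes> t j') \<in> N" by simp
    \<comment> \<open>One more factor \<open>a i'\<close> completes the square of
      \<open>a i' t j'\<close>.\<close>
    then have "a i' \<otimes> (t j' \<otimes> (a i' \<otimes> t j')) \<in> N" using N.I_l_closed[OF _ a] by simp
    then have "a i' \<otimes> t j' \<otimes> (a i' \<otimes> t j') \<in> N" using a tc by (simp add: I.m_assoc)
    then show ?case using square_mem[OF I.I_l_closed[OF t a]] by simp
  qed
  then show ?case by blast
qed

text \<open>Right multiplication by \<open>u\<close> moves every \<open>b j\<close> into
  \<open>I\<close> and keeps the convolutions zero, so \<open>armendariz\<close> applies;
  \<open>r\<close> enters only afterwards, through \<open>mult_mem_insert\<close>.\<close>

lemma convolution_mem_insert:
  fixes a b :: "nat \<Rightarrow> 'a"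
  assumes a: "\<And>i. a i \<in> carrier R" and b: "\<And>j. b j \<in> carrier R"
    and conv: "\<And>k. (\<Oplus>i\<in>{..k}. a i \<otimes> b (k - i)) = \<zero>"
    and "r \<in> carrier R" "u \<in> I"
  shows "a i \<otimes> r \<otimes> b j \<otimes> u \<in> N"
proof -
  have u: "u \<in> carrier R" and bu: "b l \<otimes> u \<in> I" for l
    using assms I.Icarr I.I_l_closed by auto
  have "(\<Oplus>l\<in>{..k}. a l \<otimes> (b (k - l) \<otimes> u)) \<in> N" for k
  proof -
    have "(\<Oplus>l\<in>{..k}. a l \<otimes> (b (k - l) \<otimes> u)) = (\<Oplus>l\<in>{..k}. a l \<otimes> b (k - l) \<otimes> u)"
      using a b u by (simp add: I.m_assoc)
    also have "\<dots> = (\<Oplus>l\<in>{..k}. a l \<otimes> b (k - l)) \<otimes> u"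
      using a b u by (intro I.finsum_ldistr[symmetric]) auto
    finally show ?thesis using conv u by simp
  qed
  then have "a i \<otimes> (b j \<otimes> u) \<in> N" using armendariz[of a "\<lambda>l. b l \<otimes> u"] a bu by blast
  then have "a i \<otimes> r \<otimes> (b j \<otimes> u) \<in> N" using mult_mem_insert a bu assms(4) by blast
  then show ?thesis using a b u assms(4) by (simp add: I.m_assoc)
qed

end

section \<open>Lifting the property from the quotient\<close>

text \<open>A degree bound survives because \<open>h\<close> preserves zero. This makes
  coefficientwise reduction modulo \<open>I\<close> available.\<close>

lemma (in ring_hom_ring) comp_mem_up:
  assumes "f \<in> up R"
  shows "h \<circ> f \<in> up S"
proof -
  obtain n where "bound \<zero> n f" using assms R.bound_upD by blast
  then have "bound \<zero>\<^bsub>S\<^esub> n (h \<circ> f)" by (auto simp: bound_def)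
  then show ?thesis using assms by (auto intro!: mem_upI simp: mem_upD)
qed

lemma zero_FactRing: "\<zero>\<^bsub>R Quot I\<^esub> = I"
  by (simp add: FactRing_def)

text \<open>Translates polynomial products into convolutions of coefficient sequences, the form
  required by \<open>convolution_mem_insert\<close>.\<close>

lemma strongly_nil_IFP_iff:
  "strongly_nil_IFP A \<longleftrightarrow>
    (\<forall>f\<in>up A. \<forall>g\<in>up A.
      (\<forall>k. (\<Oplus>\<^bsub>A\<^esub>i\<in>{..k}. f i \<otimes>\<^bsub>A\<^esub> g (k - i)) = \<zero>\<^bsub>A\<^esub>) \<longrightarrow>
      (\<forall>i j. \<forall>r\<in>carrier A. f i \<otimes>\<^bsub>A\<^esub> r \<otimes>\<^bsub>A\<^esub> g j \<in> nilpotents A))"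
  by (simp add: strongly_nil_IFP_def coeffs_of_def UP_def fun_eq_iff)

theorem proposition3p9:
  fixes R :: "('a, 'm) ring_scheme" and I :: "'a set"
  assumes "ring R"
    and "ideal I R"
    and "strongly_nil_IFP (R Quot I)"
    and "semicommutative_ideal I R"
  shows "strongly_nil_IFP R"
  unfolding strongly_nil_IFP_iff
proof (intro ballI impI allI)
  interpret R: ring R by fact
  interpret I: ideal I R by fact
  interpret N: ideal "nilpotents R \<inter> I" R
    using R.ideal_nilpotents_semicommutative_ideal assms(4) .
  interpret reduced_ideal_mod I "nilpotents R \<inter> I" R
  proof
    fix x assume x: "x \<in> I" "x \<otimes>\<^bsub>R\<^esub> x \<in> nilpotents R \<inter> I"
    have "x [^]\<^bsub>R\<^esub> (2::nat) = x \<otimes>\<^bsub>R\<^esub> x"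
      using x I.Icarr by (simp add: numeral_2_eq_2)
    then show "x \<in> nilpotents R \<inter> I" using x R.nilpotents_pow[of x 2] I.Icarr by simp
  qed
  interpret h: ring_hom_ring R "R Quot I" "(+>\<^bsub>R\<^esub>) I" by (rule I.rcos_ring_hom_ring)
  let ?h = "(+>\<^bsub>R\<^esub>) I"
  fix f g i j r
  assume f: "f \<in> up R" and g: "g \<in> up R" and r: "r \<in> carrier R"
    and conv: "\<forall>k. (\<Oplus>\<^bsub>R\<^esub>i\<in>{..k}. f i \<otimes>\<^bsub>R\<^esub> g (k - i)) = \<zero>\<^bsub>R\<^esub>"
  have fc: "f l \<in> carrier R" and gc: "g l \<in> carrier R" for l using f g by auto
  let ?c = "f i \<otimes>\<^bsub>R\<^esub> r \<otimes>\<^bsub>R\<^esub> g j"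
  have c: "?c \<in> carrier R" using fc gc r by simp
  \<comment> \<open>The coset map is applied to each vanishing convolution of \<open>f\<close> and
    \<open>g\<close>.\<close>
  have "(\<Oplus>\<^bsub>R Quot I\<^esub>i\<in>{..k}. (?h \<circ> f) i \<otimes>\<^bsub>R Quot I\<^esub> (?h \<circ> g) (k - i)) = \<zero>\<^bsub>R Quot I\<^esub>" for k
  proof -
    have "?h (\<Oplus>\<^bsub>R\<^esub>i\<in>{..k}. f i \<otimes>\<^bsub>R\<^esub> g (k - i))
        = (\<Oplus>\<^bsub>R Quot I\<^esub>i\<in>{..k}. (?h \<circ> f) i \<otimes>\<^bsub>R Quot I\<^esub> (?h \<circ> g) (k - i))"
      using fc gc by (subst h.hom_finsum) (auto simp: comp_def)
    then show ?thesis using conv by simp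
  qed
  moreover have "?h r \<in> carrier (R Quot I)" using r by simp
  ultimately have "(?h \<circ> f) i \<otimes>\<^bsub>R Quot I\<^esub> ?h r \<otimes>\<^bsub>R Quot I\<^esub> (?h \<circ> g) j \<in> nilpotents (R Quot I)"
    using assms(3) h.comp_mem_up[OF f] h.comp_mem_up[OF g]
    unfolding strongly_nil_IFP_iff by blast
  then have "?h ?c \<in> nilpotents (R Quot I)" using fc gc r by simp
  then obtain n :: nat where "n > 0" "?h ?c [^]\<^bsub>R Quot I\<^esub> n = \<zero>\<^bsub>R Quot I\<^esub>"
    unfolding nilpotents_def by blast
  then have "?h (?c [^]\<^bsub>R\<^esub> n) = \<zero>\<^bsub>R Quot I\<^esub>" using h.hom_nat_pow[OF c] by metis
  then have "?h (?c [^]\<^bsub>R\<^esub> n) = I" unfolding zero_FactRing .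
  then have "?c [^]\<^bsub>R\<^esub> n \<in> I" by (rule I.rcos_const_imp_mem[OF R.nat_pow_closed[OF c]])
  \<comment> \<open>The element \<open>u\<close> is the \<open>n\<close>-th power of
    \<open>?c\<close>, and the factor in front of it is \<open>?c\<close> itself.\<close>
  then have "?c \<otimes>\<^bsub>R\<^esub> ?c [^]\<^bsub>R\<^esub> n \<in> nilpotents R"
    using convolution_mem_insert[of f g r _ i j] fc gc r conv by blast
  then have "?c [^]\<^bsub>R\<^esub> Suc n \<in> nilpotents R" using R.nat_pow_Suc2[OF c] by metis
  then show "?c \<in> nilpotents R" using R.nilpotents_pow[OF c] by blast
qed

end
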